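(* Suppose that the following statement holds: a family of sets $\mathcal{A}$ is a finite power set if and only if either $\mathcal{A}=\{\emptyset\}$, or $\mathcal{A}$ is union-closed and separating with $\max_{x\in\bigcup_{A\in\mathcal{A}}A}|\mathcal{A}_{\{x\}}|=\frac{|\mathcal{A}|}{2}$. Then for every union-closed family $\mathcal{A}$, there exists an element of $\bigcup_{A\in\mathcal{A}}A$ that belongs to at least $\frac{|\mathcal{A}|}{2}$ member sets of $\mathcal{A}$.
   Context: A family of sets $\mathcal{A}$ is union-closed if it is a finite nonempty collection of distinct finite sets, at least one of which is nonempty, such that $X,Y\in\mathcal{A}$ implies $X\cup Y\in\mathcal{A}$. The base set of $\mathcal{A}$ is $\bigcup_{A\in\mathcal{A}}A$. For an element $x$, $\mathcal{A}_{\{x\}}=\{A\in\mathcal{A} : x\in A\}$. A family $\mathcal{F}$ is separating if for all $x,y\in\bigcup_{F\in\mathcal{F}}F$, $\mathcal{F}_{\{x\}}=\mathcal{F}_{\{y\}}$ implies $x=y$. A finite power set is a family consisting of all subsets of some finite set. *)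

theory Defs
  imports Complex_Main
begin

text \<open>The base set of a family \<open>\<A>\<close> is \<open>\<Union>\<A>\<close>.\<close>

definition union_closed :: "'a set set \<Rightarrow> bool" where
  "union_closed \<A> \<longleftrightarrow>
     finite \<A> \<and> \<A> \<noteq> {} \<and> (\<forall>X\<in>\<A>. finite X) \<and> (\<exists>X\<in>\<A>. X \<noteq> {}) \<and>
     (\<forall>X\<in>\<A>. \<forall>Y\<in>\<A>. X \<union> Y \<in> \<A>)"

definition members_at :: "'a set set \<Rightarrow> 'a \<Rightarrow> 'a set set" where
  "members_at \<A> x = {A \<in> \<A>. x \<in> A}"

definition separating :: "'a set set \<Rightarrow> bool" where
  "separating \<F> \<longleftrightarrow>
     (\<forall>x\<in>\<Union>\<F>. \<forall>y\<in>\<Union>\<F>. members_at \<F> x = members_at \<F> y \<longrightarrow> x = y)"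

definition finite_power_set :: "'a set set \<Rightarrow> bool" where
  "finite_power_set \<A> \<longleftrightarrow> (\<exists>S. finite S \<and> \<A> = Pow S)"

text \<open>For a union-closed \<open>\<A>\<close> the set over which the maximum is taken is finite and
  nonempty, so that \<open>Max\<close> is meaningful. Elsewhere its value is unspecified.\<close>

definition max_frequency :: "'a set set \<Rightarrow> nat" where
  "max_frequency \<A> = Max ((\<lambda>x. card (members_at \<A> x)) ` \<Union>\<A>)"

end

theory Submission
  imports Defs
begin

text \<open>Suppose every element of a union-closed family \<open>\<A>\<close> lies in fewer than half of the members.
  Identifying elements that lie in the same members makes \<open>\<A>\<close> separating, and the finite base
  set can then be moved into any infinite type. Adjoining a fresh point \<open>z\<close> freely to the members,
  i.e. passing to \<open>\<A> \<union> {A \<union> {z} | A \<in> \<A>}\<close>, preserves the frequency ratio of every old element,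
  while \<open>z\<close> lies in exactly half of the members. So the new family is separating of maximum
  frequency exactly one half, hence a power set by hypothesis. But in a power set the old elements
  also have frequency one half.\<close>

lemma finite_Union_if_union_closed: "union_closed \<A> \<Longrightarrow> finite (\<Union>\<A>)"
  by (auto simp: union_closed_def)

lemma Union_nonempty_if_union_closed: "union_closed \<A> \<Longrightarrow> \<Union>\<A> \<noteq> {}"
  by (auto simp: union_closed_def)

text \<open>Inserting \<open>y\<close> is a bijection from the subsets of \<open>S\<close> that
  avoid \<open>y\<close> onto those that contain it.\<close>

lemma card_members_at_Pow:
  assumes "finite S" "y \<in> S"
  shows "2 * card (members_at (Pow S) y) = card (Pow S)"
proof -
  have "members_at (Pow S) y = insert y ` Pow (S - {y})"
  proof (intro set_eqI iffI)
    fix X assume "X \<in> members_at (Pow S) y"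
    then have "X = insert y (X - {y})" "X - {y} \<in> Pow (S - {y})"
      by (auto simp: members_at_def)
    then show "X \<in> insert y ` Pow (S - {y})" by blast
  qed (use assms in \<open>auto simp: members_at_def\<close>)
  moreover have "inj_on (insert y) (Pow (S - {y}))"
    by (auto simp: inj_on_def)
  moreover have "card S = Suc (card (S - {y}))"
    using assms by (rule card.remove)
  ultimately show ?thesis
    using assms by (simp add: card_image card_Pow del: card_Diff_singleton card_Diff_insert)
qed

definition adjoin :: "'a \<Rightarrow> 'a set set \<Rightarrow> 'a set set" where
  "adjoin z \<A> = \<A> \<union> insert z ` \<A>"

lemma Union_adjoin: "\<A> \<noteq> {} \<Longrightarrow> \<Union>(adjoin z \<A>) = insert z (\<Union>\<A>)"
  by (auto simp: adjoin_def)

lemma union_closed_adjoin: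
  assumes "union_closed \<A>"
  shows "union_closed (adjoin z \<A>)"
proof -
  have un: "X \<union> Y \<in> \<A>" if "X \<in> \<A>" "Y \<in> \<A>" for X Y
    using assms that by (auto simp: union_closed_def)
  have "X \<union> Y \<in> adjoin z \<A>" if "X \<in> adjoin z \<A>" "Y \<in> adjoin z \<A>" for X Y
    using that un unfolding adjoin_def by (auto simp: Un_insert_left Un_insert_right)
  then show ?thesis
    using assms unfolding union_closed_def by (auto simp: adjoin_def)
qed

lemma card_adjoin:
  assumes "finite \<A>" "z \<notin> \<Union>\<A>"
  shows "card (adjoin z \<A>) = 2 * card \<A>"
proof -
  have "inj_on (insert z) \<A>"
    using assms(2) by (intro inj_onI) (metis Union_iff insert_ident)
  moreover have "\<A> \<inter> insert z ` \<A> = {}"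
    using assms(2) by auto
  ultimately show ?thesis
    using assms(1) by (simp add: adjoin_def card_Un_disjoint card_image)
qed

lemma members_at_adjoin: "x \<noteq> z \<Longrightarrow> members_at (adjoin z \<A>) x = adjoin z (members_at \<A> x)"
  by (auto simp: members_at_def adjoin_def)

lemma card_members_at_adjoin:
  assumes "finite \<A>" "z \<notin> \<Union>\<A>" "x \<noteq> z"
  shows "card (members_at (adjoin z \<A>) x) = 2 * card (members_at \<A> x)"
  \<comment> \<open>The members containing \<open>x\<close> are themselves an adjoined family, built
    from \<open>members_at \<A> x\<close>, so the doubling of \<open>card_adjoin\<close> applies to
    them.\<close>
  unfolding members_at_adjoin[OF assms(3)]
  by (rule card_adjoin) (use assms in \<open>auto simp: members_at_def\<close>)

lemma card_members_at_adjoin_new: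
  assumes "z \<notin> \<Union>\<A>"
  shows "card (members_at (adjoin z \<A>) z) = card \<A>"
proof -
  have "members_at (adjoin z \<A>) z = insert z ` \<A>"
    using assms by (auto simp: members_at_def adjoin_def)
  moreover have "inj_on (insert z) \<A>"
    using assms by (intro inj_onI) (metis Union_iff insert_ident)
  ultimately show ?thesis by (simp add: card_image)
qed

text \<open>The equation in \<open>power\<close> is doubled to stay within the natural numbers.
  Infinity of the type leaves room for a fresh point outside the finite base set.\<close>

lemma exists_frequent_element_if_separating:
  fixes \<A> :: "'u set set"
  assumes inf: "infinite (UNIV :: 'u set)"
    and power: "\<And>\<B> :: 'u set set. union_closed \<B> \<Longrightarrow> separating \<B> \<Longrightarrow>
      2 * max_frequency \<B> = card \<B> \<Longrightarrow> finite_power_set \<B>"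
    and uc: "union_closed \<A>" and sep: "separating \<A>"
  shows "\<exists>x\<in>\<Union>\<A>. card \<A> \<le> 2 * card (members_at \<A> x)"
proof (rule ccontr)
  assume "\<not> ?thesis"
  then have rare: "2 * card (members_at \<A> x) < card \<A>" if "x \<in> \<Union>\<A>" for x
    using that by (auto simp: not_le)
  have fin: "finite \<A>" and ne: "\<A> \<noteq> {}"
    using uc by (auto simp: union_closed_def)
  obtain z where z: "z \<notin> \<Union>\<A>"
    using ex_new_if_finite[OF inf finite_Union_if_union_closed[OF uc]] by blast
  obtain x where x: "x \<in> \<Union>\<A>"
    using Union_nonempty_if_union_closed[OF uc] by blast
  define \<B> where "\<B> = adjoin z \<A>"
  have UB: "\<Union>\<B> = insert z (\<Union>\<A>)"
    unfolding \<B>_def by (rule Union_adjoin[OF ne])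
  have cB: "card \<B> = 2 * card \<A>"
    unfolding \<B>_def by (rule card_adjoin[OF fin z])
  have old: "card (members_at \<B> y) = 2 * card (members_at \<A> y)" if "y \<in> \<Union>\<A>" for y
    unfolding \<B>_def by (rule card_members_at_adjoin[OF fin z]) (use that z in blast)
  have new: "card (members_at \<B> z) = card \<A>"
    unfolding \<B>_def by (rule card_members_at_adjoin_new[OF z])
  have ucB: "union_closed \<B>"
    unfolding \<B>_def by (rule union_closed_adjoin[OF uc])
  \<comment> \<open>The maximum is attained at \<open>z\<close>: an old element has twice its
    frequency in \<A>, which is below \<open>card \<A>\<close> by \<open>rare\<close>.\<close>
  have "max_frequency \<B> = card \<A>"
    unfolding max_frequency_def
  proof (rule Max_eqI)
    show "finite ((\<lambda>x. card (members_at \<B> x)) ` \<Union>\<B>)"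
      using finite_Union_if_union_closed[OF ucB] by blast
    show "card \<A> \<in> (\<lambda>x. card (members_at \<B> x)) ` \<Union>\<B>"
      using new UB by (intro image_eqI[of _ _ z]) auto
  next
    fix k assume "k \<in> (\<lambda>x. card (members_at \<B> x)) ` \<Union>\<B>"
    then obtain y where "k = card (members_at \<B> y)" "y = z \<or> y \<in> \<Union>\<A>"
      using UB by auto
    then show "k \<le> card \<A>"
      using new old rare by fastforce
  qed
  moreover have "separating \<B>"
    unfolding separating_def
  proof (intro ballI impI)
    fix a b assume ab: "a \<in> \<Union>\<B>" "b \<in> \<Union>\<B>" "members_at \<B> a = members_at \<B> b"
    show "a = b"
    \<comment> \<open>Frequency alone tells \<open>z\<close> apart from the old elements, whose
      frequency in \<B> is strictly below \<open>card \<A>\<close>.\<close>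
    proof (cases "a = z \<or> b = z")
      case True
      then show ?thesis
        using ab UB new old rare by (metis insertE less_irrefl)
    next
      case False
      \<comment> \<open>As \<A> is contained in \<B>, intersecting with \<A> reduces the case of two
        old elements to \<open>sep\<close>.\<close>
      have restrict: "members_at \<A> c = members_at \<B> c \<inter> \<A>" for c
        by (auto simp: members_at_def \<B>_def adjoin_def)
      have "members_at \<A> a = members_at \<A> b"
        unfolding restrict ab(3) ..
      moreover have "a \<in> \<Union>\<A>" "b \<in> \<Union>\<A>"
        using False ab UB by auto
      ultimately show ?thesis
        using sep unfolding separating_def by blast
    qed
  qed
  ultimately have "finite_power_set \<B>"
    using power ucB cB by simp
  then obtain S where S: "finite S" "\<B> = Pow S"
    by (auto simp: finite_power_set_def)
  have "x \<in> S"
    using x S UB by auto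
  \<comment> \<open>The old element \<open>x\<close> lies in half of \<B>, hence in half of \<A>,
    against \<open>rare\<close>.\<close>
  then have "2 * card (members_at \<B> x) = card \<B>"
    using card_members_at_Pow[OF S(1)] S(2) by simp
  then show False
    using old[OF x] rare[OF x] cB by simp
qed

text \<open>The map \<open>f\<close> merges elements that lie in the same members. Each member is a
  union of such classes, so passing to images loses no member and no incidence.\<close>

lemma exists_separating_quotient:
  fixes \<A> :: "'a set set"
  assumes inf: "infinite (UNIV :: 'u set)" and uc: "union_closed \<A>"
  obtains \<B> :: "'u set set" and f :: "'a \<Rightarrow> 'u"
  where "union_closed \<B>" "separating \<B>" "\<Union>\<B> = f ` \<Union>\<A>" "card \<B> = card \<A>"
    "\<And>x. x \<in> \<Union>\<A> \<Longrightarrow> card (members_at \<B> (f x)) = card (members_at \<A> x)"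
proof -
  have "finite (members_at \<A> ` \<Union>\<A>)"
    using finite_Union_if_union_closed[OF uc] by blast
  \<comment> \<open>The finitely many classes can be named injectively by elements of an infinite
    type.\<close>
  then obtain g :: "'a set set \<Rightarrow> 'u" where g: "inj_on g (members_at \<A> ` \<Union>\<A>)"
    using infinite_arbitrarily_large[OF inf] finite_same_card_bij bij_betw_imp_inj_on by metis
  define f where "f x = g (members_at \<A> x)" for x
  have mem: "f x \<in> f ` X \<longleftrightarrow> x \<in> X" if "X \<in> \<A>" "x \<in> \<Union>\<A>" for x X
  proof
    assume "f x \<in> f ` X"
    then obtain y where y: "y \<in> X" "f x = f y" by blast
    then have "members_at \<A> x = members_at \<A> y"
      using inj_onD[OF g] that unfolding f_def by blast
    then show "x \<in> X"
      using y that by (auto simp: members_at_def)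
  qed blast
  \<comment> \<open>By \<open>mem\<close>, a member is recovered from its image as the set of base
    elements that \<open>f\<close> sends into it.\<close>
  have inj: "inj_on ((`) f) \<A>"
    using mem by (intro inj_onI set_eqI) (metis UnionI)
  define \<B> where "\<B> = (`) f ` \<A>"
  have at: "members_at \<B> (f x) = (`) f ` members_at \<A> x" if "x \<in> \<Union>\<A>" for x
    using mem that by (auto simp: members_at_def \<B>_def)
  show thesis
  proof
    have "f ` X \<union> f ` Y \<in> \<B>" if "X \<in> \<A>" "Y \<in> \<A>" for X Y
      using uc that by (auto simp: \<B>_def union_closed_def image_Un[symmetric])
    then show "union_closed \<B>"
      using uc by (auto simp: union_closed_def \<B>_def)
    show UB: "\<Union>\<B> = f ` \<Union>\<A>"
      by (auto simp: \<B>_def)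
    show "card \<B> = card \<A>"
      unfolding \<B>_def by (rule card_image[OF inj])
    show "card (members_at \<B> (f x)) = card (members_at \<A> x)" if "x \<in> \<Union>\<A>" for x
      unfolding at[OF that]
      by (rule card_image[OF inj_on_subset[OF inj]]) (auto simp: members_at_def)
    show "separating \<B>"
      unfolding separating_def UB
    proof (intro ballI impI; elim imageE; hypsubst)
      fix x y assume xy: "x \<in> \<Union>\<A>" "y \<in> \<Union>\<A>" "members_at \<B> (f x) = members_at \<B> (f y)"
      \<comment> \<open>Taking images under \<open>f\<close> is injective on members, so it cancels
        from the two families.\<close>
      have "members_at \<A> x = members_at \<A> y"
        using xy(3) unfolding at[OF xy(1)] at[OF xy(2)]
        by (subst (asm) inj_on_image_eq_iff[OF inj]) (auto simp: members_at_def)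
      then show "f x = f y"
        by (simp add: f_def)
    qed
  qed
qed

theorem theorem4p4:
  assumes "infinite (UNIV :: 'u set)"
    and "\<forall>\<A> :: 'u set set.
           finite_power_set \<A> \<longleftrightarrow>
             \<A> = {{}} \<or>
             (union_closed \<A> \<and> separating \<A> \<and> real (max_frequency \<A>) = real (card \<A>) / 2)"
  shows "\<forall>\<A> :: 'a set set. union_closed \<A> \<longrightarrow>
           (\<exists>x\<in>\<Union>\<A>. real (card (members_at \<A> x)) \<ge> real (card \<A>) / 2)"
proof (intro allI impI)
  fix \<A> :: "'a set set"
  assume "union_closed \<A>"
  \<comment> \<open>The hypothesis speaks of families over \<open>'u\<close> only, so \<A> is first
    replaced by its separating quotient there.\<close>
  then obtain \<B> :: "'u set set" and f :: "'a \<Rightarrow> 'u"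
    where \<B>: "union_closed \<B>" "separating \<B>" "\<Union>\<B> = f ` \<Union>\<A>" "card \<B> = card \<A>"
      "\<And>x. x \<in> \<Union>\<A> \<Longrightarrow> card (members_at \<B> (f x)) = card (members_at \<A> x)"
    using exists_separating_quotient[OF assms(1)] by blast
  have "finite_power_set \<C>"
    if "union_closed \<C>" "separating \<C>" "2 * max_frequency \<C> = card \<C>" for \<C> :: "'u set set"
  proof -
    have "real (max_frequency \<C>) = real (card \<C>) / 2"
      unfolding that(3)[symmetric] by simp
    then show ?thesis
      using assms(2) that by blast
  qed
  then obtain y where "y \<in> \<Union>\<B>" "card \<B> \<le> 2 * card (members_at \<B> y)"
    using exists_frequent_element_if_separating[OF assms(1) _ \<B>(1,2)] by blast
  then obtain x where "x \<in> \<Union>\<A>" "card \<A> \<le> 2 * card (members_at \<A> x)"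
    using \<B>(3-5) by (metis imageE)
  then show "\<exists>x\<in>\<Union>\<A>. real (card (members_at \<A> x)) \<ge> real (card \<A>) / 2"
    by (intro bexI[of _ x]) auto
qed

end
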